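(* Let $z$ be a constant. Then even for $k=1$, any streaming algorithm that, with probability at least $\frac{2}{3}$, simultaneously outputs a $2$-approximation to the optimal $(k,z)$-clustering cost at all times of a dynamic (insertion-deletion) stream of length $n$ for points in $\{0,1\}^d$ with $d=\Omega(\log n)$ must use $\Omega(\log^2 n)$ bits of space.
   Context: In a dynamic stream, each update either inserts a point or deletes a previously inserted point; the current dataset $X$ is the multiset of points inserted and not deleted. The optimal $(k,z)$-clustering cost of $X$ is $\min_{C\subset\mathbb{R}^d,|C|=k}\sum_{x\in X}\min_{c\in C}\|x-c\|_2^z$. A $2$-approximation to a quantity $\mathrm{OPT}$ is a value in $[\mathrm{OPT},2\,\mathrm{OPT}]$ (up to the usual convention of a factor-2 approximation). *)

theory Defs
  imports "HOL-Probability.Probability" "HOL-Library.Landau_Symbols"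
begin

section \<open>Clustering cost\<close>

text \<open>The dimension varies with the stream length, so points of \<open>d\<close>-dimensional space are functions
  that are \<open>undefined\<close> outside \<open>{..<d}\<close>; equality of such functions is equality of points.\<close>

type_synonym point = "nat \<Rightarrow> real"

definition space_R :: "nat \<Rightarrow> point set" where
  "space_R d = {..<d} \<rightarrow>\<^sub>E UNIV"

definition hypercube :: "nat \<Rightarrow> point set" where
  "hypercube d = {..<d} \<rightarrow>\<^sub>E {0, 1}"

definition eucl_dist :: "nat \<Rightarrow> point \<Rightarrow> point \<Rightarrow> real" where
  "eucl_dist d x y = L2_set (\<lambda>i. x i - y i) {..<d}"

definition clustering_cost :: "nat \<Rightarrow> real \<Rightarrow> point set \<Rightarrow> point multiset \<Rightarrow> real" where
  "clustering_cost d z C X = (\<Sum>x\<in>#X. Min ((\<lambda>c. eucl_dist d x c powr z) ` C))"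

text \<open>The minimum over \<open>C\<close> is written as an infimum; for \<open>k = 1\<close> and \<open>z > 0\<close> it is attained.\<close>

definition opt_cost :: "nat \<Rightarrow> nat \<Rightarrow> real \<Rightarrow> point multiset \<Rightarrow> real" where
  "opt_cost d k z X =
     (INF C\<in>{C. C \<subseteq> space_R d \<and> finite C \<and> card C = k}. clustering_cost d z C X)"

definition two_approx :: "real \<Rightarrow> real \<Rightarrow> bool" where
  "two_approx v opt \<longleftrightarrow> opt \<le> v \<and> v \<le> 2 * opt"

section \<open>Dynamic streams\<close>

datatype update = Insert point | Delete point

fun apply_update :: "point multiset \<Rightarrow> update \<Rightarrow> point multiset" where
  "apply_update X (Insert p) = add_mset p X"
| "apply_update X (Delete p) = X - {#p#}"

definition dataset :: "update list \<Rightarrow> point multiset" where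
  "dataset \<sigma> = foldl apply_update {#} \<sigma>"

definition dynamic_stream :: "nat \<Rightarrow> nat \<Rightarrow> update list \<Rightarrow> bool" where
  "dynamic_stream d n \<sigma> \<longleftrightarrow> length \<sigma> = n \<and>
     (\<forall>t<n. case \<sigma> ! t of
        Insert p \<Rightarrow> p \<in> hypercube d
      | Delete p \<Rightarrow> p \<in># dataset (take t \<sigma>))"

section \<open>Randomized streaming algorithms\<close>

text \<open>
  The memory is a bit string, and only its length is charged. The coins are an outcome of an
  arbitrary probability space; the transition and estimate maps may consult the coins and the time
  without being charged for it. Fresh private coins are the case where the outcome is a sequence of
  independent coins and step \<open>t\<close> reads only its \<open>t\<close>-th entry; a public random tape is the case where
  the maps ignore the time.
\<close>

record 'r streaming_alg =
  coins :: "'r measure"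
  init_mem :: "'r \<Rightarrow> bool list"
  step :: "'r \<Rightarrow> nat \<Rightarrow> bool list \<Rightarrow> update \<Rightarrow> bool list"
  estimate :: "'r \<Rightarrow> nat \<Rightarrow> bool list \<Rightarrow> real"

primrec mem_at :: "'r streaming_alg \<Rightarrow> 'r \<Rightarrow> update list \<Rightarrow> nat \<Rightarrow> bool list" where
  "mem_at A \<omega> \<sigma> 0 = init_mem A \<omega>"
| "mem_at A \<omega> \<sigma> (Suc t) = step A \<omega> t (mem_at A \<omega> \<sigma> t) (\<sigma> ! t)"

definition output_at :: "'r streaming_alg \<Rightarrow> 'r \<Rightarrow> update list \<Rightarrow> nat \<Rightarrow> real" where
  "output_at A \<omega> \<sigma> t = estimate A \<omega> t (mem_at A \<omega> \<sigma> t)"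

definition uses_at_most_bits ::
  "'r streaming_alg \<Rightarrow> nat \<Rightarrow> nat \<Rightarrow> nat \<Rightarrow> bool" where
  "uses_at_most_bits A d n s \<longleftrightarrow>
     (\<forall>\<sigma>. dynamic_stream d n \<sigma> \<longrightarrow>
        (\<forall>\<omega>\<in>space (coins A). \<forall>t\<le>n. length (mem_at A \<omega> \<sigma> t) \<le> s))"

text \<open>No measurability of the maps is required: a non-measurable event has \<open>measure\<close> zero, so the
  bound below already forces the success event to be measurable.\<close>

definition tracks_opt_cost ::
  "'r streaming_alg \<Rightarrow> nat \<Rightarrow> nat \<Rightarrow> real \<Rightarrow> nat \<Rightarrow> bool" where
  "tracks_opt_cost A d k z n \<longleftrightarrow> prob_space (coins A) \<and>
     (\<forall>\<sigma>. dynamic_stream d n \<sigma> \<longrightarrow>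
        measure (coins A) {\<omega> \<in> space (coins A).
          \<forall>t\<in>{1..n}. two_approx (output_at A \<omega> \<sigma> t) (opt_cost d k z (dataset (take t \<sigma>)))}
        \<ge> 2 / 3)"

end

theory Submission
  imports Defs
begin

text \<open>
  The memory after a suitable insertion phase encodes about \<open>log\<^sup>2 n\<close> bits. Fix a code of \<open>2 ^ \<Omega>(log n)\<close>
  points of the cube in \<open>L = \<Theta>(log n)\<close> coordinates whose pairwise distances agree up to a
  constant factor. For a word \<open>p\<close> of \<open>L\<close> codewords, insert \<open>B ^ j\<close> copies of \<open>p j\<close> for every \<open>j < L\<close>,
  where \<open>B\<close> is a constant depending on \<open>z\<close>. Then, from the top level downwards, insert and delete
  \<open>B ^ j\<close> copies of each codeword \<open>q\<close> in turn, and finally delete the copies of \<open>p j\<close>. When level \<open>j\<close>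
  is on top, the optimal cost with \<open>q\<close> present is carried by the geometrically smaller lower levels if
  \<open>q = p j\<close>, and is more than twice as large otherwise. Two words that first differ, from above, at
  level \<open>j\<close> have the same updates between the end of the insertion phase and the probes of level \<open>j\<close>,
  because every codeword is probed whatever \<open>p\<close> is. So for coins on which both words are tracked
  correctly their memories after the insertion phase differ. By averaging, some coins track two
  thirds of all words.
\<close>

section \<open>A code of constant relative distance\<close>

text \<open>A set \<open>C\<close> gets the weight \<open>8 ^ (D - card C)\<close>, which sums to \<open>9 ^ D\<close> over all sets; the exponent
  then comes from \<open>9 ^ 10 \<le> 2 ^ 5 * 8 ^ 9\<close>.\<close>

lemma hamming_ball_card:
  fixes D :: nat
  defines "V \<equiv> card {C \<in> Pow {..<D}. 10 * card C \<le> D}"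
  shows "V\<^sup>2 \<le> 2 ^ D"
proof -
  define r where "r = D div 10"
  let ?W = "{C \<in> Pow {..<D}. 10 * card C \<le> D}"
  have "V * 8 ^ (D - r) = (\<Sum>C\<in>?W. 8 ^ (D - r))"
    by (simp add: V_def)
  also have "\<dots> \<le> (\<Sum>C\<in>?W. (8::nat) ^ (D - card C))"
    by (intro sum_mono power_increasing) (auto simp: r_def)
  also have "\<dots> \<le> (\<Sum>C\<in>Pow {..<D}. 8 ^ (D - card C))"
    by (intro sum_mono2) auto
  also have "\<dots> = (\<Sum>C\<in>Pow {..<D}. (\<Prod>i\<in>C. 1) * (\<Prod>i\<in>{..<D} - C. 8))"
    by (intro sum.cong refl) (auto simp: card_Diff_subset finite_subset)
  also have "\<dots> = (\<Prod>i<D. 1 + 8)"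
    by (rule prod_add [symmetric]) simp
  finally have "V * 8 ^ (D - r) \<le> 9 ^ D" by simp
  \<comment> \<open>Tenth powers clear the fraction: \<open>10 * (D - r)\<close> is at least
    \<open>9 * D\<close>, whatever the remainder of \<open>D\<close> modulo 10.\<close>
  hence "(V * 8 ^ (D - r)) ^ 10 \<le> (9 ^ D) ^ 10" by (rule power_mono) simp
  moreover have "(8::nat) ^ (9 * D) \<le> 8 ^ (10 * (D - r))"
    by (intro power_increasing) (auto simp: r_def)
  ultimately have "V ^ 10 * 8 ^ (9 * D) \<le> (9 ^ D) ^ 10"
    by (smt (verit) le_trans mult.commute mult_le_mono2 power_mult power_mult_distrib)
  also have "(9 ^ D) ^ 10 = ((9::nat) ^ 10) ^ D"
    by (metis mult.commute power_mult)
  also have "\<dots> \<le> (2 ^ 5 * 8 ^ 9) ^ D" by (intro power_mono) auto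
  also have "\<dots> = (2 ^ 5) ^ D * (8::nat) ^ (9 * D)"
    by (simp only: power_mult_distrib power_mult)
  finally have "V ^ 10 \<le> (2 ^ 5) ^ D" by simp
  also have "(2 ^ 5) ^ D = ((2::nat) ^ D) ^ 5" by (metis mult.commute power_mult)
  finally have "(V\<^sup>2) ^ 5 \<le> (2 ^ D) ^ 5" by (simp flip: power_mult)
  thus ?thesis by (simp only: power_mono_iff)
qed

text \<open>In a maximal code no set is far from all members, so the balls of radius
  \<open>D / 10\<close> around the members cover all \<open>2 ^ D\<close> sets. By
  \<open>hamming_ball_card\<close> each ball has at most \<open>2 ^ (D / 2)\<close> elements.
  Squaring \<open>card F\<close> keeps the exponent integral.\<close>

lemma gilbert_varshamov:
  "\<exists>F. F \<subseteq> Pow {..<D} \<and> 2 ^ D \<le> (card F)\<^sup>2 \<and>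
    (\<forall>A\<in>F. \<forall>B\<in>F. A \<noteq> B \<longrightarrow> D < 10 * card (sym_diff A B))"
proof -
  define code where "code F \<longleftrightarrow> F \<subseteq> Pow {..<D} \<and>
    (\<forall>A\<in>F. \<forall>B\<in>F. A \<noteq> B \<longrightarrow> D < 10 * card (sym_diff A B))" for F
  have "finite {F. code F}"
    by (rule finite_subset [of _ "Pow (Pow {..<D})"]) (auto simp: code_def)
  moreover have "code {}" by (simp add: code_def)
  ultimately have "\<exists>F\<in>{F. code F}. \<forall>G\<in>{F. code F}. F \<subseteq> G \<longrightarrow> F = G"
    by (intro finite_has_maximal) blast+
  then obtain F where F: "code F" and max: "\<And>G. code G \<Longrightarrow> F \<subseteq> G \<Longrightarrow> F = G"
    unfolding mem_Collect_eq by (elim bexE) simp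
  define ball where "ball B = {A \<in> Pow {..<D}. 10 * card (sym_diff A B) \<le> D}" for B
  have finF: "finite F" by (rule finite_subset [of _ "Pow {..<D}"]) (use F in \<open>simp_all add: code_def\<close>)
  have sub: "A \<subseteq> {..<D}" if "A \<in> F" for A using F that by (auto simp: code_def)
  have cover: "Pow {..<D} \<subseteq> (\<Union>B\<in>F. ball B)"
  proof
    fix A assume A: "A \<in> Pow {..<D}"
    show "A \<in> (\<Union>B\<in>F. ball B)"
    proof (rule ccontr)
      assume *: "A \<notin> (\<Union>B\<in>F. ball B)"
      hence far: "D < 10 * card (sym_diff A B)" if "B \<in> F" for B
        using A that by (force simp: ball_def)
      have "code (insert A F)"
        using F A far by (auto simp: code_def Un_commute)
      from max [OF this] have "A \<in> F" by blast
      with far [of A] show False by simp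
    qed
  qed
  \<comment> \<open>Symmetric difference with \<open>B\<close> is an involution that moves the
    centre of the ball to the empty set.\<close>
  have ball: "card (ball B) \<le> card {C \<in> Pow {..<D}. 10 * card C \<le> D}" if "B \<in> F" for B
  proof (rule card_inj_on_le [of "\<lambda>A. sym_diff A B"])
    have "sym_diff (sym_diff A B) B = A" for A by blast
    thus "inj_on (\<lambda>A. sym_diff A B) (ball B)" by (rule inj_on_inverseI)
    show "(\<lambda>A. sym_diff A B) ` ball B \<subseteq> {C \<in> Pow {..<D}. 10 * card C \<le> D}"
      using sub [OF that] by (auto simp: ball_def)
  qed simp
  let ?V = "card {C \<in> Pow {..<D}. 10 * card C \<le> D}"
  have "2 ^ D = card (Pow {..<D})" by (simp add: card_Pow)
  also have "\<dots> \<le> card (\<Union>B\<in>F. ball B)"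
    using finF by (intro card_mono cover) (auto simp: ball_def)
  also have "\<dots> \<le> (\<Sum>B\<in>F. card (ball B))" by (rule card_UN_le) (fact finF)
  also have "\<dots> \<le> card F * ?V" using sum_bounded_above [of F, OF ball] by simp
  finally have "(2 ^ D)\<^sup>2 \<le> (card F * ?V)\<^sup>2" by (rule power_mono) simp
  also have "\<dots> \<le> (card F)\<^sup>2 * 2 ^ D"
    unfolding power_mult_distrib by (rule mult_left_mono [OF hamming_ball_card]) simp
  finally have "2 ^ D \<le> (card F)\<^sup>2" by (simp add: power2_eq_square)
  with F [unfolded code_def] show ?thesis by (intro exI [of _ F] conjI) simp_all
qed

section \<open>The code as points of the cube\<close>

definition char_point :: "nat \<Rightarrow> nat set \<Rightarrow> point" where
  "char_point d A = (\<lambda>i\<in>{..<d}. of_bool (i \<in> A))"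

lemma char_point_hypercube: "char_point d A \<in> hypercube d"
  by (auto simp: char_point_def hypercube_def)

lemma inj_on_char_point: "inj_on (char_point d) (Pow {..<d})"
proof (rule inj_onI)
  fix A B assume *: "A \<in> Pow {..<d}" "B \<in> Pow {..<d}" "char_point d A = char_point d B"
  have "i \<in> A \<longleftrightarrow> i \<in> B" if "i < d" for i
    using fun_cong [OF *(3), of i] that by (simp add: char_point_def of_bool_eq_iff)
  thus "A = B" using * by blast
qed

lemma eucl_dist_char_point:
  assumes "A \<subseteq> {..<d}" "B \<subseteq> {..<d}"
  shows "eucl_dist d (char_point d A) (char_point d B) = sqrt (card (sym_diff A B))"
proof -
  have "(\<Sum>i<d. (char_point d A i - char_point d B i)\<^sup>2) = (\<Sum>i<d. of_bool (i \<in> sym_diff A B))"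
    by (intro sum.cong) (auto simp: char_point_def)
  also have "\<dots> = card (sym_diff A B)"
  proof -
    have "{..<d} \<inter> {i. i \<in> sym_diff A B} = sym_diff A B" using assms by blast
    thus ?thesis by (subst sum_of_bool_eq) (simp_all only: finite_lessThan)
  qed
  finally show ?thesis by (simp add: eucl_dist_def L2_set_def)
qed

text \<open>Only the first \<open>D\<close> coordinates carry the code, so the largest and smallest
  distances differ by a factor of at most \<open>sqrt 10\<close> for every \<open>d\<close>. The
  upper bound on \<open>card Q\<close> will limit the stream length, the lower bound will count
  words.\<close>

lemma hypercube_code:
  assumes "D \<le> d"
  obtains Q where "Q \<subseteq> hypercube d" "finite Q" "card Q \<le> 2 ^ D" "2 ^ D \<le> (card Q)\<^sup>2"
    "\<forall>p\<in>Q. \<forall>q\<in>Q. eucl_dist d p q \<le> sqrt D \<and> (p \<noteq> q \<longrightarrow> sqrt (D / 10) \<le> eucl_dist d p q)"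
proof -
  obtain F where F: "F \<subseteq> Pow {..<D}" "2 ^ D \<le> (card F)\<^sup>2"
    "\<forall>A\<in>F. \<forall>B\<in>F. A \<noteq> B \<longrightarrow> D < 10 * card (sym_diff A B)"
    using gilbert_varshamov [of D] by blast
  have sub_D: "A \<subseteq> {..<D}" if "A \<in> F" for A using subsetD [OF F(1) that] by simp
  have "{..<D} \<subseteq> {..<d}" using assms by simp
  hence sub: "A \<subseteq> {..<d}" if "A \<in> F" for A using sub_D [OF that] by (rule order_trans [rotated])
  have card: "card (char_point d ` F) = card F"
    by (intro card_image inj_on_subset [OF inj_on_char_point]) (use sub in blast)
  have "card F \<le> card (Pow {..<D})" by (intro card_mono F(1)) simp
  hence le: "card F \<le> 2 ^ D" by (simp add: card_Pow)
  have up: "card (sym_diff A B) \<le> D" if "A \<in> F" "B \<in> F" for A B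
  proof -
    have "sym_diff A B \<subseteq> {..<D}" using that [THEN sub_D] by blast
    from card_mono [OF finite_lessThan this] show ?thesis by (simp only: card_lessThan)
  qed
  show thesis
  proof (rule that [of "char_point d ` F"])
    show "finite (char_point d ` F)"
      by (intro finite_imageI finite_subset [OF F(1)]) simp
  next
    show "char_point d ` F \<subseteq> hypercube d" using char_point_hypercube by blast
    show "card (char_point d ` F) \<le> 2 ^ D" "2 ^ D \<le> (card (char_point d ` F))\<^sup>2"
      using le F(2) by (simp_all only: card)
  next
    show "\<forall>p\<in>char_point d ` F. \<forall>q\<in>char_point d ` F. eucl_dist d p q \<le> sqrt D \<and>
      (p \<noteq> q \<longrightarrow> sqrt (D / 10) \<le> eucl_dist d p q)"
    proof (intro ballI conjI impI)
      fix p q assume "p \<in> char_point d ` F" "q \<in> char_point d ` F"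
      then obtain A B where AB: "A \<in> F" "B \<in> F" "p = char_point d A" "q = char_point d B"
        by blast
      have dist: "eucl_dist d p q = sqrt (card (sym_diff A B))"
        unfolding AB(3,4) by (rule eucl_dist_char_point [OF AB(1,2) [THEN sub]])
      show "eucl_dist d p q \<le> sqrt D"
        unfolding dist using up [OF AB(1,2)] by (simp only: real_sqrt_le_iff of_nat_le_iff)
      assume "p \<noteq> q"
      hence "A \<noteq> B" using AB by blast
      hence less: "D < 10 * card (sym_diff A B)" by (rule F(3) [rule_format, OF AB(1,2)])
      define h where "h = card (sym_diff A B)"
      show "sqrt (D / 10) \<le> eucl_dist d p q"
        using less unfolding dist h_def [symmetric] by simp
    qed
  qed
qed

section \<open>Bounds on the optimal cost for one center\<close>

lemma eucl_dist_nonneg: "0 \<le> eucl_dist d x y"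
  by (simp add: eucl_dist_def)

lemma eucl_dist_self: "eucl_dist d x x = 0"
  by (simp add: eucl_dist_def L2_set_def)

lemma eucl_dist_commute: "eucl_dist d x y = eucl_dist d y x"
  by (simp add: eucl_dist_def L2_set_def power2_commute)

lemma eucl_dist_triangle: "eucl_dist d x y \<le> eucl_dist d x c + eucl_dist d c y"
  using L2_set_triangle_ineq [of "\<lambda>i. x i - c i" "\<lambda>i. c i - y i" "{..<d}"]
  by (simp add: eucl_dist_def)

lemma clustering_cost_center:
  "clustering_cost d z {c} X = (\<Sum>x\<in>#X. eucl_dist d x c powr z)"
  by (simp add: clustering_cost_def)

lemma clustering_cost_center_nonneg: "0 \<le> clustering_cost d z {c} X"
  unfolding clustering_cost_center by (induction X) auto

lemma opt_cost_1_le: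
  assumes "c \<in> space_R d"
  shows "opt_cost d 1 z X \<le> (\<Sum>x\<in>#X. eucl_dist d x c powr z)"
  unfolding opt_cost_def clustering_cost_center [symmetric]
  using assms clustering_cost_center_nonneg
  by (intro cINF_lower bdd_belowI2 [where m = 0]) (auto simp: card_1_singleton_iff)

lemma opt_cost_1_ge:
  assumes "\<And>c. c \<in> space_R d \<Longrightarrow> b \<le> (\<Sum>x\<in>#X. eucl_dist d x c powr z)"
  shows "b \<le> opt_cost d 1 z X"
proof -
  \<comment> \<open>The origin shows that the infimum ranges over a nonempty family, without which
    lower bounds would not pass to it.\<close>
  have "(\<lambda>i\<in>{..<d}. 0) \<in> space_R d" by (simp add: space_R_def)
  hence "{C. C \<subseteq> space_R d \<and> finite C \<and> card C = 1} \<noteq> {}"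
    by (auto simp: card_1_singleton_iff)
  thus ?thesis
    unfolding opt_cost_def
    using assms by (intro cINF_greatest) (auto simp: card_1_singleton_iff clustering_cost_center)
qed

text \<open>By the triangle inequality every center is at least half of the distance between
  \<open>p\<close> and \<open>q\<close> away from one of them, so each of the \<open>m\<close> pairs
  pays.\<close>

lemma two_clusters_opt_cost:
  assumes "0 < z" "replicate_mset m p + replicate_mset m q \<subseteq># X"
  shows "m * (eucl_dist d p q / 2) powr z \<le> opt_cost d 1 z X"
proof (rule opt_cost_1_ge)
  fix c :: point
  let ?f = "\<lambda>x. eucl_dist d x c powr z"
  obtain Y where X: "X = replicate_mset m p + replicate_mset m q + Y"
    using assms(2) by (auto simp: subset_mset.le_iff_add)
  have "eucl_dist d p q \<le> eucl_dist d p c + eucl_dist d q c"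
    using eucl_dist_triangle [of d p q c] by (simp add: eucl_dist_commute)
  hence "eucl_dist d p q / 2 \<le> eucl_dist d p c \<or> eucl_dist d p q / 2 \<le> eucl_dist d q c"
    by linarith
  hence "(eucl_dist d p q / 2) powr z \<le> ?f p + ?f q"
    using assms(1) eucl_dist_nonneg [of d p q]
    by (smt (verit) divide_nonneg_nonneg powr_ge_zero powr_mono2)
  hence "m * (eucl_dist d p q / 2) powr z \<le> m * (?f p + ?f q)"
    by (rule mult_left_mono) simp
  also have "\<dots> = (\<Sum>x\<in>#replicate_mset m p + replicate_mset m q. ?f x)"
    by (simp add: algebra_simps)
  also have "\<dots> \<le> (\<Sum>x\<in>#X. ?f x)"
    using clustering_cost_center_nonneg [of d z c Y] by (simp add: X clustering_cost_center)
  finally show "m * (eucl_dist d p q / 2) powr z \<le> (\<Sum>x\<in>#X. ?f x)" .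
qed

section \<open>The hard streams\<close>

text \<open>Validity of a stream from an arbitrary starting dataset, so that it can be checked block
  by block.\<close>

fun valid_from :: "nat \<Rightarrow> point multiset \<Rightarrow> update list \<Rightarrow> bool" where
  "valid_from d X [] \<longleftrightarrow> True"
| "valid_from d X (u # \<sigma>) \<longleftrightarrow>
     (case u of Insert p \<Rightarrow> p \<in> hypercube d | Delete p \<Rightarrow> p \<in># X) \<and>
     valid_from d (apply_update X u) \<sigma>"

lemma valid_from_append [simp]:
  "valid_from d X (\<sigma> @ \<tau>) \<longleftrightarrow> valid_from d X \<sigma> \<and> valid_from d (foldl apply_update X \<sigma>) \<tau>"
  by (induction \<sigma> arbitrary: X) auto

lemma valid_from_iff:
  "valid_from d X \<sigma> \<longleftrightarrow> (\<forall>t<length \<sigma>. case \<sigma> ! t of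
     Insert p \<Rightarrow> p \<in> hypercube d | Delete p \<Rightarrow> p \<in># foldl apply_update X (take t \<sigma>))"
  by (induction \<sigma> arbitrary: X) (simp_all add: All_less_Suc2 cong: update.case_cong)

lemma dynamic_stream_iff: "dynamic_stream d n \<sigma> \<longleftrightarrow> length \<sigma> = n \<and> valid_from d {#} \<sigma>"
  unfolding dynamic_stream_def valid_from_iff dataset_def by blast

lemma foldl_insert [simp]:
  "foldl apply_update X (replicate m (Insert p)) = X + replicate_mset m p"
  by (induction m arbitrary: X) auto

lemma foldl_delete [simp]:
  "foldl apply_update (X + replicate_mset m p) (replicate m (Delete p)) = X"
  by (induction m) auto

lemma valid_from_insert: "p \<in> hypercube d \<Longrightarrow> valid_from d X (replicate m (Insert p))"
  by (induction m arbitrary: X) auto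

lemma valid_from_delete: "valid_from d (X + replicate_mset m p) (replicate m (Delete p))"
  by (induction m) auto

section \<open>Building, probing and peeling the levels\<close>

definition levels :: "nat \<Rightarrow> (nat \<Rightarrow> point) \<Rightarrow> nat \<Rightarrow> point multiset" where
  "levels B p k = (\<Sum>j<k. replicate_mset (B ^ j) (p j))"

primrec build :: "nat \<Rightarrow> (nat \<Rightarrow> point) \<Rightarrow> nat \<Rightarrow> update list" where
  "build B p 0 = []"
| "build B p (Suc k) = build B p k @ replicate (B ^ k) (Insert (p k))"

definition probe :: "nat \<Rightarrow> point list \<Rightarrow> update list" where
  "probe m qs = concat (map (\<lambda>q. replicate m (Insert q) @ replicate m (Delete q)) qs)"

primrec peel :: "nat \<Rightarrow> point list \<Rightarrow> (nat \<Rightarrow> point) \<Rightarrow> nat \<Rightarrow> update list" where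
  "peel B qs p 0 = []"
| "peel B qs p (Suc k) = probe (B ^ k) qs @ replicate (B ^ k) (Delete (p k)) @ peel B qs p k"

lemma levels_0 [simp]: "levels B p 0 = {#}"
  and levels_Suc [simp]: "levels B p (Suc k) = levels B p k + replicate_mset (B ^ k) (p k)"
  by (simp_all add: levels_def)

lemma sum_mset_levels:
  "(\<Sum>x\<in>#levels B p k. f x :: real) = (\<Sum>j<k. real B ^ j * f (p j))"
  by (induction k) auto

lemma foldl_build [simp]: "foldl apply_update X (build B p k) = X + levels B p k"
  by (induction k) auto

lemma length_build: "length (build B p k) = (\<Sum>j<k. B ^ j)"
  by (induction k) auto

lemma valid_from_build:
  "(\<And>j. j < k \<Longrightarrow> p j \<in> hypercube d) \<Longrightarrow> valid_from d X (build B p k)"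
  by (induction k) (auto intro: valid_from_insert)

lemma probe_Nil [simp]: "probe m [] = []"
  and probe_Cons [simp]:
    "probe m (q # qs) = replicate m (Insert q) @ replicate m (Delete q) @ probe m qs"
  and probe_append [simp]: "probe m (qs @ rs) = probe m qs @ probe m rs"
  by (simp_all add: probe_def)

lemma foldl_probe [simp]: "foldl apply_update X (probe m qs) = X"
  by (induction qs arbitrary: X) auto

lemma length_probe [simp]: "length (probe m qs) = 2 * m * length qs"
  by (induction qs) auto

lemma valid_from_probe: "set qs \<subseteq> hypercube d \<Longrightarrow> valid_from d X (probe m qs)"
  by (induction qs) (auto intro: valid_from_insert valid_from_delete)

lemma length_peel: "length (peel B qs p k) = (\<Sum>j<k. B ^ j) * (2 * length qs + 1)"
  by (induction k) (auto simp: algebra_simps)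

lemma valid_from_peel:
  "set qs \<subseteq> hypercube d \<Longrightarrow> valid_from d (levels B p k) (peel B qs p k)"
  by (induction k) (auto intro: valid_from_probe valid_from_delete)

text \<open>Peeling runs from the top down and depends on the word only through the deletions, so
  words that agree above level \<open>i\<close> give the same updates until level \<open>i\<close>
  is on top.\<close>

lemma peel_common_prefix:
  assumes "i < k" "\<And>j. i < j \<Longrightarrow> j < k \<Longrightarrow> p j = p' j"
  shows "\<exists>P. peel B qs p k = P @ peel B qs p (Suc i) \<and> peel B qs p' k = P @ peel B qs p' (Suc i) \<and>
    foldl apply_update (levels B p k) P = levels B p (Suc i) \<and>
    foldl apply_update (levels B p' k) P = levels B p' (Suc i)"
  using Suc_leI [OF assms(1)] assms(2)
proof (induction k rule: dec_induct)
  case base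
  show ?case by (rule exI [of _ "[]"]) (simp del: peel.simps)
next
  case (step k)
  obtain P where P: "peel B qs p k = P @ peel B qs p (Suc i)"
    "peel B qs p' k = P @ peel B qs p' (Suc i)"
    "foldl apply_update (levels B p k) P = levels B p (Suc i)"
    "foldl apply_update (levels B p' k) P = levels B p' (Suc i)"
    using step.IH step.prems by auto
  have "p k = p' k" using step.hyps step.prems by simp
  with P show ?case
    by (intro exI [of _ "probe (B ^ k) qs @ replicate (B ^ k) (Delete (p k)) @ P"])
      (simp del: peel.simps(2) levels_Suc add: peel.simps(2) [of _ _ _ k] levels_Suc [of _ _ k])
qed

lemma peel_probe_prefix:
  assumes "i < k" "\<And>j. i < j \<Longrightarrow> j < k \<Longrightarrow> p j = p' j" "q \<in> set qs"
  obtains P R R' where "peel B qs p k = P @ R" "peel B qs p' k = P @ R'"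
    "foldl apply_update (levels B p k) P = levels B p (Suc i) + replicate_mset (B ^ i) q"
    "foldl apply_update (levels B p' k) P = levels B p' (Suc i) + replicate_mset (B ^ i) q"
proof -
  obtain P where P: "peel B qs p k = P @ peel B qs p (Suc i)"
    "peel B qs p' k = P @ peel B qs p' (Suc i)"
    "foldl apply_update (levels B p k) P = levels B p (Suc i)"
    "foldl apply_update (levels B p' k) P = levels B p' (Suc i)"
    using peel_common_prefix [of i k p p' B qs] assms(1,2) by blast
  obtain qs1 qs2 where qs: "qs = qs1 @ q # qs2"
    using assms(3) by (meson split_list)
  \<comment> \<open>What follows once the copies of \<open>q\<close> are in; probes of the codewords
    before \<open>q\<close> in \<open>qs\<close> have cancelled out.\<close>
  let ?R = "\<lambda>p. replicate (B ^ i) (Delete q) @ probe (B ^ i) qs2 @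
    replicate (B ^ i) (Delete (p i)) @ peel B qs p i"
  show thesis
    by (rule that [of "P @ probe (B ^ i) qs1 @ replicate (B ^ i) (Insert q)" "?R p" "?R p'"])
      (simp_all del: levels_Suc add: P(3,4), simp_all add: P(1,2), simp_all add: qs)
qed

section \<open>Runs on streams that share a block of updates\<close>

lemma mem_at_agree:
  assumes "mem_at A \<omega> \<sigma> a = mem_at A \<omega> \<sigma>' a" "\<And>j. j < k \<Longrightarrow> \<sigma> ! (a + j) = \<sigma>' ! (a + j)"
  shows "mem_at A \<omega> \<sigma> (a + k) = mem_at A \<omega> \<sigma>' (a + k)"
  using assms(2) by (induction k) (simp_all add: assms(1))

text \<open>For fixed coins the memory and the later updates determine the run. Since
  \<open>step\<close> may consult the time, the prefixes must have equal length; the updates in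
  \<open>R\<close> and \<open>R'\<close> are not yet read.\<close>

lemma output_at_common_suffix:
  assumes "mem_at A \<omega> (\<alpha> @ P @ R) (length \<alpha>) = mem_at A \<omega> (\<alpha>' @ P @ R') (length \<alpha>)"
    and "length \<alpha>' = length \<alpha>"
  shows "output_at A \<omega> (\<alpha> @ P @ R) (length \<alpha> + length P) =
    output_at A \<omega> (\<alpha>' @ P @ R') (length \<alpha> + length P)"
  unfolding output_at_def
  by (subst mem_at_agree [OF assms(1)]) (simp_all add: nth_append assms(2))

text \<open>The expected number of events that occur is at least \<open>c * card I\<close>, so some
  outcome attains this number.\<close>

lemma (in prob_space) exists_outcome_many_events:
  assumes "finite I" "0 < c" "\<And>i. i \<in> I \<Longrightarrow> c \<le> prob (E i)"
  shows "\<exists>\<omega>\<in>space M. c * card I \<le> card {i \<in> I. \<omega> \<in> E i}"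
proof (rule ccontr)
  assume *: "\<not> ?thesis"
  \<comment> \<open>Positive measure forces measurability, as \<open>measure\<close> is zero on
    non-measurable sets.\<close>
  have E: "E i \<in> events" if "i \<in> I" for i
    using assms(2) assms(3) [OF that] measure_notin_sets by fastforce
  have count: "(\<Sum>i\<in>I. indicator (E i) \<omega>) = real (card {i \<in> I. \<omega> \<in> E i})" for \<omega>
    using assms(1) by (simp add: indicator_def sum.If_cases Int_def)
  have int: "integrable M (indicator (E i) :: _ \<Rightarrow> real)" if "i \<in> I" for i
    using E [OF that] by (simp add: emeasure_eq_measure)
  have "c * card I \<le> (\<Sum>i\<in>I. prob (E i))"
    using sum_mono [of I "\<lambda>_. c", OF assms(3)] by (simp add: mult.commute)
  also have "\<dots> = (\<Sum>i\<in>I. expectation (indicator (E i)))"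
    using E by (intro sum.cong) auto
  also have "\<dots> = expectation (\<lambda>\<omega>. \<Sum>i\<in>I. indicator (E i) \<omega>)"
    using int by (rule Bochner_Integration.integral_sum [symmetric])
  also have "\<dots> < c * card I"
    using * int by (intro expectation_less AE_I2 Bochner_Integration.integrable_sum) (auto simp: count not_le)
  finally show False by simp
qed

section \<open>The cost gap between a probe that hits and one that misses\<close>

lemma opt_cost_probe_hit:
  assumes "p i \<in> space_R d" "0 \<le> z" "\<And>j. j < i \<Longrightarrow> eucl_dist d (p j) (p i) \<le> r"
  shows "opt_cost d 1 z (levels B p (Suc i) + replicate_mset (B ^ i) (p i))
    \<le> (\<Sum>j<i. real B ^ j) * r powr z"
proof -
  let ?f = "\<lambda>x. eucl_dist d x (p i) powr z"
  have "opt_cost d 1 z (levels B p (Suc i) + replicate_mset (B ^ i) (p i))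
      \<le> (\<Sum>x\<in>#levels B p (Suc i) + replicate_mset (B ^ i) (p i). ?f x)"
    by (rule opt_cost_1_le) fact
  also have "\<dots> = (\<Sum>j<i. real B ^ j * ?f (p j))"
    by (simp add: sum_mset_levels eucl_dist_self)
  also have "\<dots> \<le> (\<Sum>j<i. real B ^ j * r powr z)"
    using assms by (intro sum_mono mult_left_mono powr_mono2) (auto simp: eucl_dist_nonneg)
  finally show ?thesis by (simp add: sum_distrib_right)
qed

lemma opt_cost_probe_miss:
  assumes "0 < z" "r \<le> eucl_dist d (p i) q" "0 \<le> r"
  shows "real B ^ i * (r / 2) powr z
    \<le> opt_cost d 1 z (levels B p (Suc i) + replicate_mset (B ^ i) q)"
proof -
  have "real B ^ i * (r / 2) powr z \<le> real (B ^ i) * (eucl_dist d (p i) q / 2) powr z"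
    using assms by (simp add: mult_left_mono powr_mono2)
  also have "\<dots> \<le> opt_cost d 1 z (levels B p (Suc i) + replicate_mset (B ^ i) q)"
    by (rule two_clusters_opt_cost) (use assms(1) in simp_all)
  finally show ?thesis .
qed

text \<open>The radii \<open>sqrt D\<close> of a hit and \<open>sqrt (D / 10) / 2\<close> of a miss
  have ratio \<open>sqrt 40\<close>. The geometric sum times \<open>B - 1\<close> is
  \<open>B ^ i - 1\<close>, so the assumed size of \<open>B\<close> absorbs both this ratio to the
  power \<open>z\<close> and the approximation factor 2.\<close>

lemma geometric_gap:
  fixes D :: nat
  assumes "2 * sqrt 40 powr z \<le> real B - 1" "0 < D"
  shows "2 * ((\<Sum>j<i. real B ^ j) * sqrt D powr z) < real B ^ i * (sqrt (D / 10) / 2) powr z"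
proof -
  define G where "G = (\<Sum>j<i. real B ^ j)"
  have "sqrt (D / 10) / 2 = sqrt D / sqrt 40"
  proof -
    have "sqrt 40 = sqrt (10 * 4)" by simp
    also have "\<dots> = sqrt 10 * 2" by (subst real_sqrt_mult) simp
    finally show ?thesis by (simp add: real_sqrt_divide)
  qed
  hence split: "(sqrt (D / 10) / 2) powr z = sqrt D powr z / sqrt 40 powr z"
    by (simp only: powr_divide real_sqrt_ge_zero of_nat_0_le_iff zero_le_numeral)
  have "2 * sqrt 40 powr z * G \<le> (real B - 1) * G"
    using assms(1) by (intro mult_right_mono) (auto simp: G_def intro!: sum_nonneg)
  also have "\<dots> = real B ^ i - 1" by (simp add: G_def power_diff_1_eq)
  finally have "2 * G * sqrt 40 powr z < real B ^ i" by (simp add: mult.commute mult.left_commute)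
  hence "2 * G * sqrt 40 powr z * sqrt D powr z < real B ^ i * sqrt D powr z"
    using assms(2) by (intro mult_strict_right_mono) simp_all
  thus ?thesis unfolding split G_def [symmetric] by (simp add: field_simps)
qed

section \<open>Length and validity of the complete stream\<close>

lemma sum_powers_le: "2 \<le> B \<Longrightarrow> (\<Sum>j<k. B ^ j) \<le> (B :: nat) ^ k"
proof (induction k)
  case (Suc k)
  have "(\<Sum>j<Suc k. B ^ j) \<le> 2 * B ^ k" using Suc by simp
  also have "\<dots> \<le> B ^ Suc k" unfolding power_Suc using Suc.prems by (rule mult_le_mono1)
  finally show ?case .
qed simp

text \<open>The padding gives the exact length \<open>n\<close> that \<open>dynamic_stream\<close>
  demands, provided that the main part fits. It comes after all probes.\<close>

definition hard_stream :: "nat \<Rightarrow> point list \<Rightarrow> nat \<Rightarrow> nat \<Rightarrow> (nat \<Rightarrow> point) \<Rightarrow> update list" where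
  "hard_stream B qs L n p =
     (let \<sigma> = build B p L @ peel B qs p L in \<sigma> @ replicate (n - length \<sigma>) (Insert (p 0)))"

lemma dynamic_stream_hard_stream:
  assumes "set qs \<subseteq> hypercube d" "\<And>j. j < L \<Longrightarrow> p j \<in> set qs" "1 \<le> L" "2 \<le> B"
    and "length qs \<le> 2 ^ L" "(8 * B) ^ L \<le> n"
  shows "dynamic_stream d n (hard_stream B qs L n p)"
proof -
  have p: "p j \<in> hypercube d" if "j < L" for j using assms(1,2) that by blast
  have "(\<Sum>j<L. B ^ j) \<le> B ^ L" by (rule sum_powers_le) fact
  hence "(\<Sum>j<L. B ^ j) * (2 * length qs + 2) \<le> B ^ L * (2 * length qs + 2)"
    by (rule mult_right_mono) simp
  also have "\<dots> \<le> B ^ L * (4 * 2 ^ L)"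
    using assms(5) one_le_power [of "2 :: nat" L] by (intro mult_left_mono) linarith+
  \<comment> \<open>As \<open>L\<close> is at least 1, the constant 4 is absorbed into
    \<open>4 ^ L\<close>, which yields the single power \<open>(8 * B) ^ L\<close>.\<close>
  also have "\<dots> \<le> B ^ L * (4 ^ L * 2 ^ L)"
    using power_increasing [of 1 L "4 :: nat"] assms(3) by (intro mult_left_mono mult_right_mono) simp_all
  also have "\<dots> = (B * (4 * 2)) ^ L" by (simp only: power_mult_distrib)
  also have "B * (4 * 2) = 8 * B" by simp
  finally have "length (build B p L @ peel B qs p L) \<le> n"
    using assms(6) by (simp add: length_build length_peel algebra_simps)
  thus ?thesis
    using p [of 0] p assms(1,3)
    by (simp add: hard_stream_def dynamic_stream_iff Let_def valid_from_build valid_from_peel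
        valid_from_insert)
qed

section \<open>The space bound\<close>

text \<open>At the highest level \<open>i\<close> where the words differ, the probe with
  \<open>p i\<close> hits for \<open>p\<close> and misses for \<open>p'\<close>. Equal memories give
  one common output there, which cannot approximate both costs.\<close>

lemma hard_stream_memory_distinguishes:
  assumes "0 < z" "2 * sqrt 40 powr z \<le> real B - 1" "0 < L"
    and Q: "set qs \<subseteq> hypercube d"
      "\<And>x y. x \<in> set qs \<Longrightarrow> y \<in> set qs \<Longrightarrow> eucl_dist d x y \<le> sqrt L"
      "\<And>x y. x \<in> set qs \<Longrightarrow> y \<in> set qs \<Longrightarrow> x \<noteq> y \<Longrightarrow> sqrt (L / 10) \<le> eucl_dist d x y"
    and p: "\<And>j. j < L \<Longrightarrow> p j \<in> set qs" "\<And>j. j < L \<Longrightarrow> p' j \<in> set qs"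
    and len: "length (hard_stream B qs L n p) = n"
    and approx: "\<And>t \<sigma>. t \<in> {1..n} \<Longrightarrow> \<sigma> \<in> {hard_stream B qs L n p, hard_stream B qs L n p'} \<Longrightarrow>
      two_approx (output_at A \<omega> \<sigma> t) (opt_cost d 1 z (dataset (take t \<sigma>)))"
    and mem: "mem_at A \<omega> (hard_stream B qs L n p) (\<Sum>j<L. B ^ j) =
      mem_at A \<omega> (hard_stream B qs L n p') (\<Sum>j<L. B ^ j)"
    and "j < L"
  shows "p j = p' j"
proof (rule ccontr)
  assume "p j \<noteq> p' j"
  define i where "i = Max {j. j < L \<and> p j \<noteq> p' j}"
  have "i \<in> {j. j < L \<and> p j \<noteq> p' j}"
    unfolding i_def by (rule Max_in) (use \<open>j < L\<close> \<open>p j \<noteq> p' j\<close> in auto)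
  hence i: "i < L" "p i \<noteq> p' i" by auto
  have above: "p j = p' j" if "i < j" "j < L" for j
    using that Max_ge [of "{j. j < L \<and> p j \<noteq> p' j}" j] unfolding i_def by fastforce
  obtain P R R' where P: "peel B qs p L = P @ R" "peel B qs p' L = P @ R'"
    "foldl apply_update (levels B p L) P = levels B p (Suc i) + replicate_mset (B ^ i) (p i)"
    "foldl apply_update (levels B p' L) P = levels B p' (Suc i) + replicate_mset (B ^ i) (p i)"
    using i(1) above p(1) [OF i(1)] by (rule peel_probe_prefix)
  define a where "a = (\<Sum>j<L. B ^ j)"
  define t where "t = a + length P"
  have a: "length (build B p L) = a" "length (build B p' L) = a"
    by (simp_all add: length_build a_def)
  obtain S S' where stream: "hard_stream B qs L n p = build B p L @ P @ S"
    "hard_stream B qs L n p' = build B p' L @ P @ S'"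
    by (simp add: hard_stream_def P(1,2))
  have out: "output_at A \<omega> (hard_stream B qs L n p) t = output_at A \<omega> (hard_stream B qs L n p') t"
    using output_at_common_suffix [of A \<omega> "build B p L" P S "build B p' L" S'] mem
    unfolding stream a t_def a_def by simp
  \<comment> \<open>Correctness is promised only from time 1 on; the term \<open>B ^ 0\<close> makes
    the insertion phase nonempty.\<close>
  have "1 \<le> a" using member_le_sum [of 0 "{..<L}" "\<lambda>j. B ^ j"] \<open>0 < L\<close> by (simp add: a_def)
  hence t: "t \<in> {1..n}" using len unfolding stream by (simp add: t_def a)
  have data: "dataset (take t (hard_stream B qs L n p)) =
      levels B p (Suc i) + replicate_mset (B ^ i) (p i)"
    "dataset (take t (hard_stream B qs L n p')) =
      levels B p' (Suc i) + replicate_mset (B ^ i) (p i)"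
    unfolding stream dataset_def t_def by (simp_all only: take_append a) (simp_all add: a P(3,4))
  \<comment> \<open>The common output is at most twice the cost of the hit and at least the cost of
    the miss.\<close>
  define v where "v = output_at A \<omega> (hard_stream B qs L n p) t"
  have "p i \<in> space_R d"
    using p(1) [OF i(1)] Q(1) by (auto simp: hypercube_def space_R_def)
  hence "v \<le> 2 * ((\<Sum>j<i. real B ^ j) * sqrt L powr z)"
    using approx [OF t, of "hard_stream B qs L n p"] opt_cost_probe_hit [of p i d z "sqrt L" B]
      p(1) i(1) Q(2) \<open>0 < z\<close>
    unfolding data two_approx_def v_def by fastforce
  moreover have "sqrt (L / 10) \<le> eucl_dist d (p' i) (p i)"
    using Q(3) p i by metis
  hence "real B ^ i * (sqrt (L / 10) / 2) powr z \<le> v"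
    using approx [OF t, of "hard_stream B qs L n p'"] \<open>0 < z\<close>
      opt_cost_probe_miss [of z "sqrt (L / 10)" d p' i "p i" B]
    unfolding data two_approx_def v_def out by fastforce
  ultimately show False using geometric_gap [OF assms(2,3), of i] by linarith
qed

text \<open>Two thirds of the \<open>card Q ^ L\<close> words need distinct memories after the
  insertion phase, and \<open>card Q\<close> is at least \<open>2 ^ (L / 2)\<close>.\<close>

lemma tracking_space_lower_bound:
  assumes "0 < z" "2 * sqrt 40 powr z \<le> real B - 1" "2 \<le> B"
    and "1 \<le> L" "L \<le> d" "(8 * B) ^ L \<le> n"
    and track: "tracks_opt_cost A d 1 z n" and bits: "uses_at_most_bits A d n s"
  shows "L\<^sup>2 \<le> 2 * (s + 2)"
proof -
  obtain Q where Q: "Q \<subseteq> hypercube d" "finite Q" "card Q \<le> 2 ^ L" "2 ^ L \<le> (card Q)\<^sup>2"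
    "\<forall>p\<in>Q. \<forall>q\<in>Q. eucl_dist d p q \<le> sqrt L \<and> (p \<noteq> q \<longrightarrow> sqrt (L / 10) \<le> eucl_dist d p q)"
    by (rule hypercube_code [OF assms(5)])
  obtain qs where qs: "set qs = Q" "length qs = card Q"
    using finite_distinct_list [OF Q(2)] distinct_card by metis
  define PP where "PP = {..<L} \<rightarrow>\<^sub>E Q"
  let ?str = "hard_stream B qs L n"
  have card_PP: "card PP = card Q ^ L" "finite PP"
    using Q(2) by (simp_all add: PP_def card_PiE finite_PiE)
  have PP: "p j \<in> set qs" if "p \<in> PP" "j < L" for p j
    using that by (auto simp: PP_def qs)
  have stream: "dynamic_stream d n (?str p)" if "p \<in> PP" for p
    using PP [OF that] assms(3,4,6) Q(1,3) by (intro dynamic_stream_hard_stream) (auto simp: qs)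
  interpret prob_space "coins A" using track by (simp add: tracks_opt_cost_def)
  define E where "E p = {\<omega> \<in> space (coins A).
    \<forall>t\<in>{1..n}. two_approx (output_at A \<omega> (?str p) t) (opt_cost d 1 z (dataset (take t (?str p))))}" for p
  have "2 / 3 \<le> prob (E p)" if "p \<in> PP" for p
    using track stream [OF that] unfolding tracks_opt_cost_def E_def by blast
  then obtain \<omega> where \<omega>: "\<omega> \<in> space (coins A)"
    and many: "2 / 3 * card PP \<le> card {p \<in> PP. \<omega> \<in> E p}"
    using exists_outcome_many_events [of PP "2 / 3" E] card_PP(2) by auto
  define a where "a = (\<Sum>j<L. B ^ j)"
  have inj: "inj_on (\<lambda>p. mem_at A \<omega> (?str p) a) {p \<in> PP. \<omega> \<in> E p}"
  proof (rule inj_onI)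
    fix p p' assume p: "p \<in> {p \<in> PP. \<omega> \<in> E p}" "p' \<in> {p \<in> PP. \<omega> \<in> E p}"
      and mem: "mem_at A \<omega> (?str p) a = mem_at A \<omega> (?str p') a"
    have "p j = p' j" if "j < L" for j
    proof (rule hard_stream_memory_distinguishes [OF assms(1,2)])
      show "length (?str p) = n" using stream [of p] p by (simp add: dynamic_stream_def)
      show "two_approx (output_at A \<omega> \<sigma> t) (opt_cost d 1 z (dataset (take t \<sigma>)))"
        if "t \<in> {1..n}" "\<sigma> \<in> {?str p, ?str p'}" for t \<sigma>
        using p that by (auto simp: E_def)
      show "mem_at A \<omega> (?str p) (\<Sum>j<L. B ^ j) = mem_at A \<omega> (?str p') (\<Sum>j<L. B ^ j)"
        using mem by (simp add: a_def)
    qed (use Q qs PP p assms(4) that in auto)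
    thus "p = p'" using p unfolding PP_def by (intro PiE_ext [of p "{..<L}" "\<lambda>_. Q" p']) auto
  qed
  \<comment> \<open>The space bound applies only up to time \<open>n\<close>. There is a word to
    take the stream from, since \<open>Q(4)\<close> makes the code nonempty.\<close>
  have "a \<le> n"
  proof (cases "PP = {}")
    case False
    then obtain p where "p \<in> PP" by blast
    from stream [OF this] show ?thesis
      by (auto simp: dynamic_stream_def hard_stream_def Let_def length_build a_def)
  qed (use card_PP Q(4) in auto)
  hence "(\<lambda>p. mem_at A \<omega> (?str p) a) ` {p \<in> PP. \<omega> \<in> E p} \<subseteq> {xs. set xs \<subseteq> UNIV \<and> length xs \<le> s}"
    using bits stream \<omega> by (auto simp: uses_at_most_bits_def)
  hence "card {p \<in> PP. \<omega> \<in> E p} \<le> card {xs :: bool list. set xs \<subseteq> UNIV \<and> length xs \<le> s}"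
    by (intro card_inj_on_le [OF inj] finite_lists_length_le) auto
  also have "\<dots> = (\<Sum>i<Suc s. 2 ^ i)"
    by (subst card_lists_length_le) (simp_all add: lessThan_Suc_atMost)
  also have "\<dots> \<le> 2 ^ Suc s" by (rule sum_powers_le) simp
  \<comment> \<open>One extra bit pays for memories shorter than \<open>s\<close>, another for
    weakening 2/3 to 1/2.\<close>
  finally have "card PP \<le> 2 * 2 ^ Suc s" using many by linarith
  hence le: "card Q ^ L \<le> 2 ^ (s + 2)" by (simp add: card_PP)
  have "(2 :: nat) ^ (L\<^sup>2) = (2 ^ L) ^ L" by (simp add: power_mult power2_eq_square)
  also have "\<dots> \<le> ((card Q)\<^sup>2) ^ L" by (intro power_mono Q(4)) simp
  also have "\<dots> = (card Q ^ L)\<^sup>2" by (simp flip: power_mult add: mult.commute)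
  also have "\<dots> \<le> (2 ^ (s + 2))\<^sup>2" by (intro power_mono le) simp
  also have "\<dots> = 2 ^ (2 * (s + 2))" by (simp only: power_mult [symmetric] mult.commute)
  finally show ?thesis by (rule power_le_imp_le_exp [rotated]) simp
qed

theorem theorem1p4:
  fixes z :: real
    and d :: "nat \<Rightarrow> nat"
    and A :: "nat \<Rightarrow> 'r streaming_alg"
    and s :: "nat \<Rightarrow> nat"
  assumes "z > 0"
    and "(\<lambda>n. real (d n)) \<in> \<Omega>(\<lambda>n. ln (real n))"
    and "\<forall>\<^sub>F n in sequentially. tracks_opt_cost (A n) (d n) 1 z n"
    and "\<forall>\<^sub>F n in sequentially. uses_at_most_bits (A n) (d n) n (s n)"
  shows "(\<lambda>n. real (s n)) \<in> \<Omega>(\<lambda>n. (ln (real n))\<^sup>2)"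
proof -
  \<comment> \<open>This bound gives both the gap condition on \<open>B - 1\<close> and
    \<open>2 \<le> B\<close>.\<close>
  obtain B :: nat where B: "2 + 2 * sqrt 40 powr z \<le> real B" using real_arch_simple by blast
  hence B2: "2 \<le> B" using powr_ge_zero [of "sqrt 40" z] by linarith
  obtain c where c: "c > 0" "\<forall>\<^sub>F n in sequentially. c * norm (ln (real n)) \<le> norm (real (d n))"
    using assms(2) by (rule landau_omega.bigE)
  define b where "b = ln (8 * real B)"
  have "b > 0" using B2 by (simp add: b_def)
  \<comment> \<open>For \<open>L\<close> the floor of \<open>a * ln n\<close>, the bound by
    \<open>c\<close> makes \<open>L\<close> coordinates available and the bound by
    \<open>1 / b\<close> makes \<open>(8 * B) ^ L\<close> at most \<open>n\<close>.\<close>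
  define a where "a = min c (1 / b)"
  have a: "0 < a" "a \<le> c" "a * b \<le> 1"
    using c(1) \<open>b > 0\<close> by (auto simp: a_def min_def field_simps)
  \<comment> \<open>For \<open>x = a * ln n\<close> at least 8, the floor exceeds
    \<open>x - 1\<close>, hence is at least \<open>x / 2 + 3\<close>; the square of the 3 outweighs
    the additive 4 in \<open>2 * (s n + 2)\<close>.\<close>
  have "\<forall>\<^sub>F n in sequentially. 8 \<le> a * ln (real n)"
    using a(1) by real_asymp
  hence "\<forall>\<^sub>F n in sequentially. a\<^sup>2 / 16 * norm ((ln (real n))\<^sup>2) \<le> norm (real (s n))"
    using c(2) assms(3,4) eventually_ge_at_top [of 1]
  proof eventually_elim
    case (elim n)
    define L where "L = nat \<lfloor>a * ln (real n)\<rfloor>"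
    have L: "real L \<le> a * ln (real n)" "a * ln (real n) < real L + 1"
      using elim(1) by (auto simp: L_def)
    have "ln (real n) \<ge> 0" using elim by simp
    have "real L \<le> real (d n)"
      using L(1) mult_right_mono [OF a(2) \<open>ln (real n) \<ge> 0\<close>] elim(2) \<open>ln (real n) \<ge> 0\<close> by simp
    have "ln ((8 * real B) ^ L) = real L * b"
      unfolding b_def by (rule ln_realpow)
    also have "\<dots> \<le> a * ln (real n) * b" using L(1) \<open>b > 0\<close> by (intro mult_right_mono) auto
    also have "\<dots> = a * b * ln (real n)" by simp
    also have "\<dots> \<le> 1 * ln (real n)" by (intro mult_right_mono a) fact
    finally have "(8 * real B) ^ L \<le> real n"
      using B2 elim(5) by (simp add: ln_le_cancel_iff)
    hence n: "(8 * B) ^ L \<le> n"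
      by (simp only: of_nat_le_iff [symmetric, where ?'a = real]) simp
    have "L\<^sup>2 \<le> 2 * (s n + 2)"
      using B B2 L elim \<open>real L \<le> real (d n)\<close> n
      by (intro tracking_space_lower_bound [OF assms(1) _ B2 _ _ n elim(3,4)]) auto
    hence "(real L)\<^sup>2 \<le> 2 * (real (s n) + 2)"
      by (simp only: of_nat_le_iff [symmetric, where ?'a = real]) simp
    moreover have "(a * ln (real n) / 2 + 3)\<^sup>2 \<le> (real L)\<^sup>2"
      using L(2) elim(1) by (intro power_mono) auto
    moreover have "(a * ln (real n) / 2)\<^sup>2 + 9 \<le> (a * ln (real n) / 2 + 3)\<^sup>2"
      using elim(1) by (simp add: power2_sum)
    ultimately have "(a * ln (real n))\<^sup>2 / 8 \<le> real (s n)"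
      by (simp add: power_divide)
    moreover have "0 \<le> (a * ln (real n))\<^sup>2" by simp
    ultimately have "(a * ln (real n))\<^sup>2 / 16 \<le> real (s n)" by linarith
    thus ?case by (simp add: power_mult_distrib)
  qed
  thus ?thesis using a(1) by (intro landau_omega.bigI [of "a\<^sup>2 / 16"]) simp_all
qed

end
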